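(* Let $G$ be a connected block graph. (a) If $v$ is a vertex of $G$, then $M_{G}\leq M_{G,v}$. (b) If $B$ is a block of $G$, then $M_{G}\leq M^*_{G,B}$.
   Context: Graphs are finite, simple and undirected. A block graph is a graph in which every block is a complete graph. Connected induced subgraphs are taken on nonempty vertex sets. For a graph $G$: $M_G$ denotes the mean (average) order of all connected induced subgraphs of $G$; for a vertex $v$ of $G$, $M_{G,v}$ denotes the mean order of all connected induced subgraphs of $G$ that contain $v$; for a block $B$ of $G$, $M^*_{G,B}$ denotes the mean order of all connected induced subgraphs of $G$ that contain at least one vertex of $B$. The order of a graph is its number of vertices. *)

theory Defs
  imports Complex_Main "Graph_Theory.Graph_Theory"
begin

text \<open>
  Finite simple undirected graphs are the symmetric digraphs of the locale \<^locale>\<open>graph\<close> (finite, no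
  loops, no parallel arcs). An undirected edge is represented by its two opposite arcs.
\<close>

text \<open>
  A cut vertex separates two other vertices of the same component.
\<close>
definition cut_vertex :: "('a, 'b) pre_digraph \<Rightarrow> 'a \<Rightarrow> bool" where
  "cut_vertex G v \<longleftrightarrow> v \<in> verts G \<and>
     (\<exists>x \<in> verts G - {v}. \<exists>y \<in> verts G - {v}.
        x \<rightarrow>\<^sup>*\<^bsub>G\<^esub> y \<and> \<not> x \<rightarrow>\<^sup>*\<^bsub>pre_digraph.del_vert G v\<^esub> y)"

text \<open>
  The conjunct \<^term>\<open>graph H\<close> is needed because a library \<^const>\<open>subgraph\<close> may contain just one of the
  two arcs of an edge. A cut vertex is a cut vertex of the subgraph, not of the ambient graph. The
  one-vertex graph is its own (complete) block.
\<close>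
definition block :: "('a, 'b) pre_digraph \<Rightarrow> ('a, 'b) pre_digraph \<Rightarrow> bool" where
  "block G B \<longleftrightarrow>
     pre_digraph.max_subgraph G
       (\<lambda>H. graph H \<and> Digraph_Component.connected H \<and> (\<nexists>v. cut_vertex H v)) B"

definition block_graph :: "('a, 'b) pre_digraph \<Rightarrow> bool" where
  "block_graph G \<longleftrightarrow> graph G \<and> (\<forall>B. block G B \<longrightarrow> complete_digraph (card (verts B)) B)"

text \<open>
  Nonemptiness of the vertex set is part of the library's notion of connectedness.
\<close>
definition conn_induced_subgraphs :: "('a, 'b) pre_digraph \<Rightarrow> ('a, 'b) pre_digraph set" where
  "conn_induced_subgraphs G = {H. induced_subgraph H G \<and> Digraph_Component.connected H}"

definition mean_order :: "('a, 'b) pre_digraph set \<Rightarrow> real" where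
  "mean_order \<H> = (\<Sum>H\<in>\<H>. real (card (verts H))) / real (card \<H>)"

definition M_all :: "('a, 'b) pre_digraph \<Rightarrow> real" where
  "M_all G = mean_order (conn_induced_subgraphs G)"

definition M_vertex :: "('a, 'b) pre_digraph \<Rightarrow> 'a \<Rightarrow> real" where
  "M_vertex G v = mean_order {H \<in> conn_induced_subgraphs G. v \<in> verts H}"

definition M_block :: "('a, 'b) pre_digraph \<Rightarrow> ('a, 'b) pre_digraph \<Rightarrow> real" where
  "M_block G B = mean_order {H \<in> conn_induced_subgraphs G. verts H \<inter> verts B \<noteq> {}}"

end

theory Submission
  imports Defs
begin

text \<open>
  Let \<open>X\<close> be the family of connected subsets of a connected set \<open>T\<close> that meet a given nonempty
  \<open>L \<subseteq> T\<close>. Growing one vertex at a time gives \<open>|T| \<le> |X|\<close>, so every member of \<open>X\<close> has at most \<open>|X|\<close>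
  vertices; hence adding the empty set to \<open>X\<close> lowers its mean order by at most 1.

  In a block graph, splitting off a component of the complement of a vertex \<open>v\<close>, or the branch at
  a vertex of a block, leaves two connected sides joined by a complete bipartite graph between
  cliques \<open>L\<close> and \<open>L'\<close>. The connected sets that cross the cut are exactly the unions of a connected
  set meeting \<open>L\<close> on one side and one meeting \<open>L'\<close> on the other, so the means on the two sides add up.
  With the bound above, each mean of a side is at most the mean of the sets meeting the root, and
  induction on the number of vertices, with roots a vertex or a block, shows that sets avoiding the
  root have mean order at most that of the sets meeting it.
\<close>

section \<open>Connected sets of a symmetric relation\<close>

text \<open>Connectedness phrased through cuts instead of walks: for symmetric \<open>E\<close>, no
  proper nonempty part of \<open>A\<close> is closed under adjacency within
  \<open>A\<close>.\<close>

definition conn :: "('a \<times> 'a) set \<Rightarrow> 'a set \<Rightarrow> bool" where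
  "conn E A \<longleftrightarrow> A \<noteq> {} \<and> (\<forall>B \<subseteq> A. B \<noteq> {} \<longrightarrow> B \<noteq> A \<longrightarrow> (\<exists>x\<in>B. \<exists>y\<in>A - B. (x, y) \<in> E))"

lemma connD:
  assumes "conn E A" "B \<subseteq> A" "B \<noteq> {}" "B \<noteq> A"
  obtains x y where "x \<in> B" "y \<in> A" "y \<notin> B" "(x, y) \<in> E"
  using assms unfolding conn_def by blast

lemma conn_nonempty: "conn E A \<Longrightarrow> A \<noteq> {}"
  by (simp add: conn_def)

lemma conn_singleton [simp]: "conn E {v}"
  by (auto simp: conn_def)

lemma conn_cong:
  assumes "\<And>x y. x \<in> A \<Longrightarrow> y \<in> A \<Longrightarrow> (x, y) \<in> E \<longleftrightarrow> (x, y) \<in> E'"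
  shows "conn E A \<longleftrightarrow> conn E' A"
proof -
  have "(\<exists>x\<in>B. \<exists>y\<in>A - B. (x, y) \<in> E) \<longleftrightarrow> (\<exists>x\<in>B. \<exists>y\<in>A - B. (x, y) \<in> E')" if "B \<subseteq> A" for B
    using that by (intro bex_cong refl assms) auto
  then show ?thesis by (simp add: conn_def)
qed

context
  fixes E :: "('a \<times> 'a) set"
  assumes sym: "sym E"
begin

lemma adj_commute: "(x, y) \<in> E \<longleftrightarrow> (y, x) \<in> E"
  using sym by (auto dest: symD)

text \<open>If a part contains \<open>z\<close>, its complement in \<open>A\<close> does not, and
  symmetry reverses an edge leaving that complement. So only parts missing \<open>z\<close> need
  checking.\<close>

lemma connI_point:
  assumes "z \<in> A"
    and "\<And>B. B \<subseteq> A \<Longrightarrow> z \<notin> B \<Longrightarrow> B \<noteq> {} \<Longrightarrow> \<exists>x\<in>B. \<exists>y\<in>A - B. (x, y) \<in> E"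
  shows "conn E A"
  unfolding conn_def
proof (intro conjI allI impI)
  show "A \<noteq> {}" using assms(1) by auto
next
  fix B assume B: "B \<subseteq> A" "B \<noteq> {}" "B \<noteq> A"
  show "\<exists>x\<in>B. \<exists>y\<in>A - B. (x, y) \<in> E"
  proof (cases "z \<in> B")
    case True
    with B obtain x y where "x \<in> A - B" "y \<in> A - (A - B)" "(x, y) \<in> E"
      using assms(2)[of "A - B"] by blast
    then show ?thesis using adj_commute by blast
  qed (use assms(2) B in blast)
qed

text \<open>A separation of \<open>A\<close> cannot split the connected \<open>T\<close>, so one of
  its two sides misses \<open>T\<close>; that side is \<open>Q\<close>.\<close>

lemma not_connE:
  assumes "\<not> conn E A" "conn E T" "T \<subseteq> A"
  obtains Q where "Q \<subseteq> A" "Q \<noteq> {}" "Q \<inter> T = {}" "\<And>x y. x \<in> Q \<Longrightarrow> y \<in> A - Q \<Longrightarrow> (x, y) \<notin> E"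
proof -
  have "A \<noteq> {}" using assms conn_nonempty by fastforce
  with assms(1) obtain B where B: "B \<subseteq> A" "B \<noteq> {}" "B \<noteq> A" "\<forall>x\<in>B. \<forall>y\<in>A - B. (x, y) \<notin> E"
    unfolding conn_def by blast
  have "T \<inter> B = {} \<or> T \<subseteq> B"
    using connD[OF assms(2), of "T \<inter> B"] B(4) assms(3) by blast
  then show thesis
  proof
    assume "T \<inter> B = {}"
    with B show thesis by (intro that[of B]) auto
  next
    assume "T \<subseteq> B"
    with B show thesis using adj_commute by (intro that[of "A - B"]) blast+
  qed
qed

lemma conn_Un:
  assumes "conn E A" "conn E B" "x \<in> A" "y \<in> B" "(x, y) \<in> E"
  shows "conn E (A \<union> B)"
proof (rule connI_point[of x])
  show "x \<in> A \<union> B" using assms by auto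
next
  fix C assume C: "C \<subseteq> A \<union> B" "x \<notin> C" "C \<noteq> {}"
  show "\<exists>u\<in>C. \<exists>w\<in>A \<union> B - C. (u, w) \<in> E"
  proof (cases "C \<inter> A = {}")
    case False
    then show ?thesis using connD[OF assms(1), of "C \<inter> A"] C assms(3) by blast
  next
    case True
    then have "C \<subseteq> B" using C by auto
    show ?thesis
    proof (cases "C = B")
      case True
      then show ?thesis using assms C adj_commute by blast
    next
      case False
      then show ?thesis using connD[OF assms(2) \<open>C \<subseteq> B\<close> C(3)] by blast
    qed
  qed
qed

lemma conn_insert:
  "conn E A \<Longrightarrow> x \<in> A \<Longrightarrow> (x, y) \<in> E \<Longrightarrow> conn E (insert y A)"
  using conn_Un[of A "{y}" x y] by simp

text \<open>\<open>Q\<close> can be attached to the rest of \<open>D\<close> only through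
  \<open>z\<close>. An edge leaving a part of \<open>D - Q\<close> that misses \<open>z\<close>
  therefore cannot end in \<open>Q\<close>.\<close>

lemma conn_Diff:
  assumes "conn E D" "z \<in> D" "z \<notin> Q" "\<And>x y. x \<in> Q \<Longrightarrow> y \<in> D - Q - {z} \<Longrightarrow> (x, y) \<notin> E"
  shows "conn E (D - Q)"
proof (rule connI_point[of z])
  show "z \<in> D - Q" using assms by auto
next
  fix B assume B: "B \<subseteq> D - Q" "z \<notin> B" "B \<noteq> {}"
  then have "B \<subseteq> D" "B \<noteq> {}" "B \<noteq> D" using assms(2) by auto
  then obtain x y where xy: "x \<in> B" "y \<in> D" "y \<notin> B" "(x, y) \<in> E"
    by (rule connD[OF assms(1)])
  then have "x \<in> D - Q - {z}" "(y, x) \<in> E" using B adj_commute[of x y] by auto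
  then have "y \<notin> Q" using assms(4) by blast
  with xy show "\<exists>x\<in>B. \<exists>y\<in>D - Q - B. (x, y) \<in> E" by blast
qed

lemma component_exists:
  assumes "finite U" "u \<in> U"
  obtains C where "u \<in> C" "C \<subseteq> U" "conn E C" "\<And>x y. x \<in> C \<Longrightarrow> y \<in> U - C \<Longrightarrow> (x, y) \<notin> E"
proof -
  let ?S = "{C. u \<in> C \<and> C \<subseteq> U \<and> conn E C}"
  have "finite ?S" using assms(1) by simp
  moreover have "{u} \<in> ?S" using assms(2) by simp
  then have "?S \<noteq> {}" by (metis empty_iff)
  ultimately have "\<exists>C\<in>?S. \<forall>C'\<in>?S. C \<subseteq> C' \<longrightarrow> C = C'"
    by (rule finite_has_maximal)
  then obtain C where "C \<in> ?S" and max: "\<forall>C'\<in>?S. C \<subseteq> C' \<longrightarrow> C = C'" by (rule bexE)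
  then have C: "u \<in> C" "C \<subseteq> U" "conn E C" by simp_all
  show thesis
  proof (rule that[OF C], rule notI)
    fix x y assume xy: "x \<in> C" "y \<in> U - C" and "(x, y) \<in> E"
    then have "insert y C \<in> ?S" using conn_insert[of C x y] C by simp
    then have "C \<subseteq> insert y C \<longrightarrow> C = insert y C" by (rule bspec[OF max])
    then show False using xy by blast
  qed
qed

text \<open>A singleton from \<open>L\<close> can be enlarged inside \<open>T\<close> one vertex at
  a time, so every size from 1 to \<open>card T\<close> occurs among the sets counted.\<close>

lemma card_le_card_conn_meeting:
  assumes "finite T" "conn E T" "L \<subseteq> T" "L \<noteq> {}"
  shows "card T \<le> card {A. A \<subseteq> T \<and> conn E A \<and> A \<inter> L \<noteq> {}}"
proof -
  let ?X = "{A. A \<subseteq> T \<and> conn E A \<and> A \<inter> L \<noteq> {}}"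
  have grow: "\<exists>A. A \<subseteq> T \<and> conn E A \<and> A \<inter> L \<noteq> {} \<and> card A = Suc k" if "Suc k \<le> card T" for k
    using that
  proof (induction k)
    case 0
    from assms(4) obtain l where "l \<in> L" by auto
    then show ?case using assms(3) by (intro exI[of _ "{l}"]) auto
  next
    case (Suc k)
    then obtain A where A: "A \<subseteq> T" "conn E A" "A \<inter> L \<noteq> {}" "card A = Suc k" by auto
    then have "A \<noteq> T" using Suc.prems by auto
    from connD[OF assms(2) A(1) conn_nonempty[OF A(2)] this]
    obtain x y where xy: "x \<in> A" "y \<in> T" "y \<notin> A" "(x, y) \<in> E" .
    have "card (insert y A) = Suc (Suc k)"
      using A xy finite_subset[OF A(1) assms(1)] by simp
    moreover have "conn E (insert y A)" using conn_insert[OF A(2) xy(1,4)] .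
    ultimately show ?case using A xy by (intro exI[of _ "insert y A"]) auto
  qed
  have "{1..card T} \<subseteq> card ` ?X"
  proof
    fix n assume "n \<in> {1..card T}"
    then have "Suc (n - 1) = n" "n \<le> card T" by auto
    with grow[of "n - 1"] show "n \<in> card ` ?X" by auto
  qed
  moreover have "finite ?X" using assms(1) by simp
  ultimately have "card {1..card T} \<le> card ?X" by (meson card_image_le card_mono finite_imageI le_trans)
  then show ?thesis by simp
qed

end

section \<open>Crossing a cut that is a complete join of two cliques\<close>

definition clique :: "('a \<times> 'a) set \<Rightarrow> 'a set \<Rightarrow> bool" where
  "clique E K \<longleftrightarrow> (\<forall>x\<in>K. \<forall>y\<in>K. x \<noteq> y \<longrightarrow> (x, y) \<in> E)"

text \<open>The edges between the two sides form the complete bipartite graph on \<open>L\<close>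
  and \<open>L'\<close>. The clique conditions ensure that a connected set crossing the cut has
  connected traces on both sides.\<close>

definition clique_cut :: "('a \<times> 'a) set \<Rightarrow> 'a set \<Rightarrow> 'a set \<Rightarrow> 'a set \<Rightarrow> 'a set \<Rightarrow> bool" where
  "clique_cut E T L T' L' \<longleftrightarrow> T \<inter> T' = {} \<and> L \<subseteq> T \<and> L' \<subseteq> T' \<and> clique E L \<and> clique E L' \<and>
     (\<forall>x\<in>T. \<forall>y\<in>T'. (x, y) \<in> E \<longleftrightarrow> x \<in> L \<and> y \<in> L')"

definition conn_sets :: "('a \<times> 'a) set \<Rightarrow> 'a set \<Rightarrow> 'a set set" where
  "conn_sets E W = {A. A \<subseteq> W \<and> conn E A}"

definition meeting :: "('a \<times> 'a) set \<Rightarrow> 'a set \<Rightarrow> 'a set \<Rightarrow> 'a set set" where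
  "meeting E W R = {A. A \<subseteq> W \<and> conn E A \<and> A \<inter> R \<noteq> {}}"

definition avoiding :: "('a \<times> 'a) set \<Rightarrow> 'a set \<Rightarrow> 'a set \<Rightarrow> 'a set set" where
  "avoiding E W R = {A. A \<subseteq> W \<and> conn E A \<and> A \<inter> R = {}}"

definition order_sum :: "'a set set \<Rightarrow> real" where
  "order_sum \<A> = (\<Sum>A\<in>\<A>. real (card A))"

lemma finite_meeting [simp]: "finite W \<Longrightarrow> finite (meeting E W R)"
  and finite_avoiding [simp]: "finite W \<Longrightarrow> finite (avoiding E W R)"
  by (auto simp: meeting_def avoiding_def)

lemma order_sum_Un:
  "finite \<A> \<Longrightarrow> finite \<B> \<Longrightarrow> \<A> \<inter> \<B> = {} \<Longrightarrow> order_sum (\<A> \<union> \<B>) = order_sum \<A> + order_sum \<B>"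
  unfolding order_sum_def by (rule sum.union_disjoint)

context
  fixes E :: "('a \<times> 'a) set"
  assumes sym: "sym E"
begin

lemma clique_cut_commute: "clique_cut E T L T' L' \<Longrightarrow> clique_cut E T' L' T L"
  unfolding clique_cut_def by (metis Int_commute adj_commute[OF sym])

text \<open>A nonempty part of \<open>A \<inter> T\<close> without edges to the rest of
  \<open>A \<inter> T\<close> must be left by an edge into \<open>T'\<close>, hence contains a
  vertex of \<open>L\<close>. Were \<open>A \<inter> T\<close> disconnected, both pieces would meet
  the clique \<open>L\<close>, and two such vertices are adjacent.\<close>

lemma conn_Int_clique_cut:
  assumes cut: "clique_cut E T L T' L'" and A: "conn E A" "A \<subseteq> T \<union> T'" "A \<inter> T \<noteq> {}" "A \<inter> T' \<noteq> {}"
  shows "conn E (A \<inter> T)" "A \<inter> T \<inter> L \<noteq> {}"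
proof -
  have exit: "B \<inter> L \<noteq> {}" if B: "B \<subseteq> A \<inter> T" "B \<noteq> {}" "\<And>x y. x \<in> B \<Longrightarrow> y \<in> A \<inter> T - B \<Longrightarrow> (x, y) \<notin> E" for B
  proof -
    have "B \<subseteq> A" "B \<noteq> A" using B(1) A(4) cut by (auto simp: clique_cut_def)
    then obtain x y where xy: "x \<in> B" "y \<in> A" "y \<notin> B" "(x, y) \<in> E"
      using connD[OF A(1)] B(2) by metis
    then have "y \<in> T'" using B(3) A(2) by blast
    then show ?thesis using xy B(1) cut unfolding clique_cut_def by blast
  qed
  show "A \<inter> T \<inter> L \<noteq> {}" using exit[of "A \<inter> T"] A(3) by blast
  show "conn E (A \<inter> T)"
  proof (rule ccontr)
    assume nc: "\<not> conn E (A \<inter> T)"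
    then obtain B where B: "B \<subseteq> A \<inter> T" "B \<noteq> {}" "B \<noteq> A \<inter> T" "\<forall>x\<in>B. \<forall>y\<in>A \<inter> T - B. (x, y) \<notin> E"
      using A(3) unfolding conn_def by blast
    have "B \<inter> L \<noteq> {}" using exit[of B] B by blast
    moreover have "(A \<inter> T - B) \<inter> L \<noteq> {}"
      using B symD[OF sym] by (intro exit[of "A \<inter> T - B"]) auto
    ultimately obtain p q where "p \<in> B" "p \<in> L" "q \<in> A \<inter> T - B" "q \<in> L" by blast
    moreover from this have "p \<noteq> q" by blast
    ultimately have "(p, q) \<in> E" using cut by (simp add: clique_cut_def clique_def)
    then show False using B(4) \<open>p \<in> B\<close> \<open>q \<in> A \<inter> T - B\<close> by blast
  qed
qed

text \<open>One direction takes the traces on the two sides. In the other, a vertex of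
  \<open>L\<close> in one set is adjacent to a vertex of \<open>L'\<close> in the other, which joins
  them.\<close>

lemma crossing_eq:
  assumes cut: "clique_cut E T L T' L'"
  shows "{A. A \<subseteq> T \<union> T' \<and> conn E A \<and> A \<inter> T \<noteq> {} \<and> A \<inter> T' \<noteq> {}} =
    (\<lambda>(X, Y). X \<union> Y) ` (meeting E T L \<times> meeting E T' L')" (is "?L = ?R")
proof
  show "?L \<subseteq> ?R"
  proof
    fix A assume "A \<in> ?L"
    then have A: "conn E A" "A \<subseteq> T \<union> T'" "A \<inter> T \<noteq> {}" "A \<inter> T' \<noteq> {}" by auto
    have "A \<inter> T \<in> meeting E T L"
      using conn_Int_clique_cut[OF cut A] by (auto simp: meeting_def)
    moreover have "A \<inter> T' \<in> meeting E T' L'"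
      using conn_Int_clique_cut[OF clique_cut_commute[OF cut]] A by (auto simp: meeting_def Un_commute)
    moreover have "A = (A \<inter> T) \<union> (A \<inter> T')" using A by auto
    ultimately show "A \<in> ?R" by (auto intro: image_eqI[of _ _ "(A \<inter> T, A \<inter> T')"])
  qed
  show "?R \<subseteq> ?L"
  proof clarify
    fix X Y assume XY: "X \<in> meeting E T L" "Y \<in> meeting E T' L'"
    then obtain x y where "x \<in> X" "x \<in> L" "y \<in> Y" "y \<in> L'" by (auto simp: meeting_def)
    moreover from this have "(x, y) \<in> E" using cut unfolding clique_cut_def by blast
    ultimately have "conn E (X \<union> Y)" using XY conn_Un[OF sym] by (auto simp: meeting_def)
    then show "X \<union> Y \<subseteq> T \<union> T' \<and> conn E (X \<union> Y) \<and> (X \<union> Y) \<inter> T \<noteq> {} \<and> (X \<union> Y) \<inter> T' \<noteq> {}"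
      using XY by (auto simp: meeting_def)
  qed
qed

lemma inj_on_crossing:
  assumes "T \<inter> T' = {}"
  shows "inj_on (\<lambda>(X, Y). X \<union> Y) (meeting E T L \<times> meeting E T' L')"
proof (rule inj_onI, clarify)
  fix X Y X' Y' assume "X \<in> meeting E T L" "Y \<in> meeting E T' L'" "X' \<in> meeting E T L" "Y' \<in> meeting E T' L'"
    and "X \<union> Y = X' \<union> Y'"
  with assms show "X = X' \<and> Y = Y'" unfolding meeting_def by blast
qed

text \<open>Taking unions is a bijection from pairs onto crossing sets, and sizes add because the
  sides are disjoint. Dividing the second formula by the first shows that the mean orders
  add.\<close>

lemma card_order_sum_crossing:
  assumes cut: "clique_cut E T L T' L'" and fin: "finite T" "finite T'"
  defines "Z \<equiv> {A. A \<subseteq> T \<union> T' \<and> conn E A \<and> A \<inter> T \<noteq> {} \<and> A \<inter> T' \<noteq> {}}"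
  shows "card Z = card (meeting E T L) * card (meeting E T' L')"
    and "order_sum Z = order_sum (meeting E T L) * card (meeting E T' L') + card (meeting E T L) * order_sum (meeting E T' L')"
proof -
  let ?X = "meeting E T L" and ?Y = "meeting E T' L'"
  have dis: "T \<inter> T' = {}" using cut by (simp add: clique_cut_def)
  have Z: "Z = (\<lambda>(X, Y). X \<union> Y) ` (?X \<times> ?Y)"
    unfolding Z_def by (rule crossing_eq[OF cut])
  show "card Z = card ?X * card ?Y"
    unfolding Z card_image[OF inj_on_crossing[OF dis]] by (rule card_cartesian_product)
  have "order_sum Z = (\<Sum>(X, Y)\<in>?X \<times> ?Y. real (card (X \<union> Y)))"
    unfolding order_sum_def Z sum.reindex[OF inj_on_crossing[OF dis]] by (auto intro: sum.cong)
  also have "\<dots> = (\<Sum>(X, Y)\<in>?X \<times> ?Y. real (card X) + real (card Y))"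
  proof (rule sum.cong[OF refl], clarify)
    fix X Y assume "X \<in> ?X" "Y \<in> ?Y"
    then have XY: "X \<subseteq> T" "Y \<subseteq> T'" by (auto simp: meeting_def)
    then have "X \<inter> Y = {}" using dis by blast
    then show "real (card (X \<union> Y)) = real (card X) + real (card Y)"
      using card_Un_disjoint[OF finite_subset[OF XY(1) fin(1)] finite_subset[OF XY(2) fin(2)]] by simp
  qed
  also have "\<dots> = (\<Sum>X\<in>?X. \<Sum>Y\<in>?Y. real (card X) + real (card Y))"
    by (rule sum.cartesian_product[symmetric])
  also have "\<dots> = order_sum ?X * card ?Y + card ?X * order_sum ?Y"
    by (simp add: sum.distrib order_sum_def sum_distrib_right sum_distrib_left mult.commute)
  finally show "order_sum Z = order_sum ?X * card ?Y + card ?X * order_sum ?Y" .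
qed

text \<open>Members are nonempty, so their mean order is at least 1. Each has at most
  \<open>card T\<close> vertices, and \<open>card T \<le> card X\<close> by growing connected sets
  from \<open>L\<close>.\<close>

lemma order_sum_meeting_bounds:
  assumes "finite T" "conn E T" "L \<subseteq> T" "L \<noteq> {}"
  defines "X \<equiv> meeting E T L"
  shows "real (card X) \<le> order_sum X" "order_sum X \<le> real (card X) * real (card X)" "0 < card X"
proof -
  have fin: "finite X" using assms by simp
  have sub: "finite A" "A \<noteq> {}" "card A \<le> card T" if "A \<in> X" for A
    using that assms(1) conn_nonempty by (auto simp: X_def meeting_def intro: finite_subset card_mono)
  have T: "card T \<le> card X"
    using card_le_card_conn_meeting[OF sym assms(1-4)] by (simp add: X_def meeting_def)
  have "(\<Sum>A\<in>X. 1) \<le> order_sum X"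
    unfolding order_sum_def
  proof (rule sum_mono)
    fix A assume "A \<in> X"
    then have "card A \<noteq> 0" using sub[of A] by simp
    then show "1 \<le> real (card A)" by simp
  qed
  then show "real (card X) \<le> order_sum X" by simp
  have "order_sum X \<le> (\<Sum>A\<in>X. real (card X))"
    unfolding order_sum_def using sub T by (intro sum_mono) (meson le_trans of_nat_mono)
  then show "order_sum X \<le> real (card X) * real (card X)" by simp
  have "card T \<noteq> 0" using assms by auto
  with T show "0 < card X" by simp
qed


text \<open>A connected subset of \<open>T \<union> T'\<close> crosses the cut, lies in
  \<open>T\<close>, or lies in \<open>T'\<close>. Crossing sets meet both \<open>L\<close> and
  \<open>L'\<close>, while a set on one side misses the clique of the other.\<close>

lemma
  assumes cut: "clique_cut E T L T' L'"
  defines "Z \<equiv> {A. A \<subseteq> T \<union> T' \<and> conn E A \<and> A \<inter> T \<noteq> {} \<and> A \<inter> T' \<noteq> {}}"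
  shows meeting_one_side: "meeting E (T \<union> T') L' = Z \<union> meeting E T' L'"
    and avoiding_one_side:
      "avoiding E (T \<union> T') L' = meeting E T L \<union> avoiding E T L \<union> avoiding E T' L'"
    and meeting_both_sides:
      "meeting E (T \<union> T') (L \<union> L') = Z \<union> meeting E T L \<union> meeting E T' L'"
    and avoiding_both_sides:
      "avoiding E (T \<union> T') (L \<union> L') = avoiding E T L \<union> avoiding E T' L'"
proof -
  have dis: "T \<inter> T' = {}" "L \<subseteq> T" "L' \<subseteq> T'" using cut by (auto simp: clique_cut_def)
  have L: "A \<inter> L \<noteq> {}" and L': "A \<inter> L' \<noteq> {}" if "A \<in> Z" for A
    using that conn_Int_clique_cut(2)[OF cut, of A]
      conn_Int_clique_cut(2)[OF clique_cut_commute[OF cut], of A]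
    by (auto simp: Z_def Un_commute)
  have sides: "A \<subseteq> T \<union> T' \<and> conn E A \<longleftrightarrow> A \<in> Z \<or> A \<subseteq> T \<and> conn E A \<or> A \<subseteq> T' \<and> conn E A" for A
    by (auto simp: Z_def)
  show "meeting E (T \<union> T') L' = Z \<union> meeting E T' L'"
  proof (rule set_eqI)
    fix A
    have "A \<subseteq> T \<Longrightarrow> A \<inter> L' = {}" using dis by blast
    then show "A \<in> meeting E (T \<union> T') L' \<longleftrightarrow> A \<in> Z \<union> meeting E T' L'"
      using sides[of A] L'[of A] by (auto simp: meeting_def)
  qed
  show "avoiding E (T \<union> T') L' = meeting E T L \<union> avoiding E T L \<union> avoiding E T' L'"
  proof (rule set_eqI)
    fix A
    have "A \<subseteq> T \<Longrightarrow> A \<inter> L' = {}" using dis by blast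
    then show "A \<in> avoiding E (T \<union> T') L' \<longleftrightarrow> A \<in> meeting E T L \<union> avoiding E T L \<union> avoiding E T' L'"
      using sides[of A] L'[of A] by (auto simp: meeting_def avoiding_def)
  qed
  show "meeting E (T \<union> T') (L \<union> L') = Z \<union> meeting E T L \<union> meeting E T' L'"
  proof (rule set_eqI)
    fix A
    have "A \<subseteq> T \<Longrightarrow> A \<inter> L' = {}" "A \<subseteq> T' \<Longrightarrow> A \<inter> L = {}" using dis by blast+
    then show "A \<in> meeting E (T \<union> T') (L \<union> L') \<longleftrightarrow> A \<in> Z \<union> meeting E T L \<union> meeting E T' L'"
      using sides[of A] L'[of A] by (auto simp: meeting_def Int_Un_distrib)
  qed
  show "avoiding E (T \<union> T') (L \<union> L') = avoiding E T L \<union> avoiding E T' L'"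
  proof (rule set_eqI)
    fix A
    have "A \<subseteq> T \<Longrightarrow> A \<inter> L' = {}" "A \<subseteq> T' \<Longrightarrow> A \<inter> L = {}" using dis by blast+
    then show "A \<in> avoiding E (T \<union> T') (L \<union> L') \<longleftrightarrow> A \<in> avoiding E T L \<union> avoiding E T' L'"
      using sides[of A] L'[of A] by (auto simp: avoiding_def Int_Un_distrib)
  qed
qed

end

section \<open>Avoiding a root is no better than meeting it\<close>

text \<open>Here \<open>x / n\<close> and \<open>y / k\<close> are the means of the two sides. The
  right-hand side equals \<open>x / (n + 1) + y / k\<close>; the first summand, a mean with the
  empty set added, falls short of \<open>x / n\<close> by at most 1, and \<open>y / k\<close> is at
  least 1.\<close>

lemma ratio_le_one_side:
  fixes x y n k :: real
  assumes "0 < n" "0 < k" "0 \<le> x" "x \<le> n * n" "k \<le> y"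
  shows "x / n \<le> (x * k + n * y + y) / (n * k + k)" "y / k \<le> (x * k + n * y + y) / (n * k + k)"
proof -
  have eq: "(x * k + n * y + y) / (n * k + k) = x / (n + 1) + y / k"
  proof -
    have "n * k + k = k * (n + 1)" "n + 1 \<noteq> 0" "k \<noteq> 0"
      using assms by (simp_all add: algebra_simps)
    then show ?thesis by (simp add: field_simps)
  qed
  have "x / n - x / (n + 1) = x / (n * (n + 1))" using assms by (simp add: divide_simps) (simp add: algebra_simps)
  also have "\<dots> \<le> 1" using assms by (simp add: divide_simps) (simp add: algebra_simps)
  also have "\<dots> \<le> y / k" using assms by simp
  finally show "x / n \<le> (x * k + n * y + y) / (n * k + k)" using eq by simp
  show "y / k \<le> (x * k + n * y + y) / (n * k + k)" using eq assms by simp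
qed

text \<open>Cross-multiplying and cancelling leaves \<open>x * k \<le> n * n * y + n * y\<close>,
  which follows from \<open>x \<le> n * n\<close> and \<open>k \<le> y\<close>.\<close>

lemma ratio_le_both_sides:
  fixes x y n k :: real
  assumes "0 < n" "0 < k" "x \<le> n * n" "k \<le> y"
  shows "x / n \<le> (x * k + n * y + x + y) / (n * k + n + k)"
proof -
  have "x * k \<le> n * n * y" using assms by (intro mult_mono) auto
  also have "\<dots> \<le> n * (n * y) + n * y" using assms by simp
  finally have "x * (n * k + n + k) \<le> (x * k + n * y + x + y) * n" by (simp add: algebra_simps)
  then show ?thesis using assms by (simp add: divide_le_eq le_divide_eq mult.commute add_pos_pos)
qed

section \<open>Combining the two sides of a clique cut\<close>

definition mean_size :: "'a set set \<Rightarrow> real" where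
  "mean_size \<A> = order_sum \<A> / real (card \<A>)"

text \<open>The setting of the induction step. \<open>left\<close> and \<open>right\<close> are the
  induction hypotheses, multiplied out so that they add up over disjoint families and also cover the
  case that no set avoids the root.\<close>

context
  fixes E :: "('a \<times> 'a) set" and T L T' L'
  assumes sym: "sym E" and cut: "clique_cut E T L T' L'"
    and fin: "finite T" "finite T'" and conn: "conn E T" "conn E T'" and ne: "L \<noteq> {}" "L' \<noteq> {}"
    and left: "order_sum (avoiding E T L) \<le> mean_size (meeting E T L) * card (avoiding E T L)"
    and right: "order_sum (avoiding E T' L') \<le> mean_size (meeting E T' L') * card (avoiding E T' L')"
begin

private definition "n = real (card (meeting E T L))"
private definition "k = real (card (meeting E T' L'))"
private definition "x = order_sum (meeting E T L)"
private definition "y = order_sum (meeting E T' L')"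
private definition "Z = {A. A \<subseteq> T \<union> T' \<and> conn E A \<and> A \<inter> T \<noteq> {} \<and> A \<inter> T' \<noteq> {}}"

private lemma disjoint: "T \<inter> T' = {}" "L \<subseteq> T" "L' \<subseteq> T'"
  using cut by (auto simp: clique_cut_def)

private lemma bounds: "0 < n" "0 < k" "0 \<le> x" "x \<le> n * n" "n \<le> x" "y \<le> k * k" "k \<le> y"
  using order_sum_meeting_bounds[OF sym fin(1) conn(1) disjoint(2) ne(1)]
    order_sum_meeting_bounds[OF sym fin(2) conn(2) disjoint(3) ne(2)]
  by (auto simp: n_def k_def x_def y_def)

private lemma crossing: "finite Z" "real (card Z) = n * k" "order_sum Z = x * k + n * y"
  using card_order_sum_crossing[OF sym cut fin] fin by (auto simp: Z_def n_def k_def x_def y_def)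

private lemma sets_disjoint:
  "Z \<inter> meeting E T L = {}" "Z \<inter> meeting E T' L' = {}"
  "meeting E T L \<inter> meeting E T' L' = {}" "avoiding E T L \<inter> avoiding E T' L' = {}"
  "meeting E T L \<inter> avoiding E T L = {}" "meeting E T L \<inter> avoiding E T' L' = {}"
proof -
  have *: "A \<subseteq> T \<Longrightarrow> A \<subseteq> T' \<Longrightarrow> \<not> conn E A" "A \<subseteq> T \<Longrightarrow> A \<inter> T' = {}" "A \<subseteq> T' \<Longrightarrow> A \<inter> T = {}" for A
    using disjoint(1) conn_nonempty[of E A] by blast+
  show "Z \<inter> meeting E T L = {}" "Z \<inter> meeting E T' L' = {}"
    "meeting E T L \<inter> meeting E T' L' = {}" "avoiding E T L \<inter> avoiding E T' L' = {}"
    "meeting E T L \<inter> avoiding E T L = {}" "meeting E T L \<inter> avoiding E T' L' = {}"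
    using * by (auto simp: Z_def meeting_def avoiding_def)
qed

text \<open>With \<open>L'\<close> alone as root, every connected subset of \<open>T\<close> avoids
  it: those meeting \<open>L\<close> have mean \<open>x / n\<close>, those missing \<open>L\<close>
  at most that by \<open>left\<close>. The sets in \<open>T'\<close> avoiding \<open>L'\<close> have
  mean at most \<open>y / k\<close>, and both bounds are at most the new mean.\<close>

lemma mean_size_one_side:
  "order_sum (avoiding E (T \<union> T') L') \<le>
    mean_size (meeting E (T \<union> T') L') * card (avoiding E (T \<union> T') L')"
proof -
  let ?m = "mean_size (meeting E (T \<union> T') L')"
  let ?a = "real (card (avoiding E T L))" and ?b = "real (card (avoiding E T' L'))"
  have m: "?m = (x * k + n * y + y) / (n * k + k)"
    unfolding mean_size_def meeting_one_side[OF sym cut] Z_def[symmetric]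
    using crossing sets_disjoint(2) fin
    by (simp add: order_sum_Un card_Un_disjoint y_def k_def)
  have avoid: "avoiding E (T \<union> T') L' = meeting E T L \<union> avoiding E T L \<union> avoiding E T' L'"
    by (rule avoiding_one_side[OF sym cut])
  have dis: "(meeting E T L \<union> avoiding E T L) \<inter> avoiding E T' L' = {}"
    using sets_disjoint by blast
  have "order_sum (avoiding E (T \<union> T') L') = x + order_sum (avoiding E T L) + order_sum (avoiding E T' L')"
    using dis sets_disjoint(5) fin by (simp add: avoid order_sum_Un x_def)
  also have "\<dots> \<le> x / n * n + x / n * ?a + y / k * ?b"
    using left right bounds by (simp add: mean_size_def x_def n_def y_def k_def)
  also have "\<dots> \<le> ?m * n + ?m * ?a + ?m * ?b"
    unfolding m using ratio_le_one_side[of n k x y] bounds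
    by (intro add_mono mult_right_mono) auto
  also have "\<dots> = ?m * card (avoiding E (T \<union> T') L')"
    using dis sets_disjoint(5) fin by (simp add: avoid card_Un_disjoint n_def algebra_simps)
  finally show ?thesis .
qed

text \<open>A connected set avoiding both cliques cannot cross the cut, so it lies on one side and
  falls under \<open>left\<close> or \<open>right\<close>. The arithmetic bound, used once for each
  side, puts both side means below the new mean.\<close>

lemma mean_size_both_sides:
  "order_sum (avoiding E (T \<union> T') (L \<union> L')) \<le>
    mean_size (meeting E (T \<union> T') (L \<union> L')) * card (avoiding E (T \<union> T') (L \<union> L'))"
proof -
  let ?m = "mean_size (meeting E (T \<union> T') (L \<union> L'))"
  let ?a = "real (card (avoiding E T L))" and ?b = "real (card (avoiding E T' L'))"
  have dis: "(Z \<union> meeting E T L) \<inter> meeting E T' L' = {}"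
    using sets_disjoint by blast
  have m: "?m = (x * k + n * y + x + y) / (n * k + n + k)"
    unfolding mean_size_def meeting_both_sides[OF sym cut] Z_def[symmetric]
    using crossing sets_disjoint(1) dis fin
    by (simp add: order_sum_Un card_Un_disjoint x_def n_def y_def k_def)
  have avoid: "avoiding E (T \<union> T') (L \<union> L') = avoiding E T L \<union> avoiding E T' L'"
    by (rule avoiding_both_sides[OF sym cut])
  have le: "x / n \<le> ?m" "y / k \<le> ?m"
    unfolding m using ratio_le_both_sides[of n k x y] ratio_le_both_sides[of k n y x] bounds
    by (auto simp: algebra_simps)
  have "order_sum (avoiding E (T \<union> T') (L \<union> L')) = order_sum (avoiding E T L) + order_sum (avoiding E T' L')"
    using sets_disjoint(4) fin by (simp add: avoid order_sum_Un)
  also have "\<dots> \<le> x / n * ?a + y / k * ?b"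
    using left right by (simp add: mean_size_def x_def n_def y_def k_def)
  also have "\<dots> \<le> ?m * ?a + ?m * ?b"
    using le by (intro add_mono mult_right_mono) auto
  also have "\<dots> = ?m * card (avoiding E (T \<union> T') (L \<union> L'))"
    using sets_disjoint(4) fin by (simp add: avoid card_Un_disjoint algebra_simps)
  finally show ?thesis .
qed

end

section \<open>Relations whose cut-vertex-free connected sets are cliques\<close>

text \<open>
  No vertex outside a gated set is adjacent to two of its members. Rooting at gated cliques
  makes the induction close up: splitting at a vertex leads to a clique in a branch, and splitting a
  clique leads to a vertex and a smaller clique.
\<close>
definition gated :: "('a \<times> 'a) set \<Rightarrow> 'a set \<Rightarrow> 'a set \<Rightarrow> bool" where
  "gated E W R \<longleftrightarrow> (\<forall>y\<in>W - R. \<forall>r\<in>R. \<forall>s\<in>R. (y, r) \<in> E \<longrightarrow> (y, s) \<in> E \<longrightarrow> r = s)"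

text \<open>A relational substitute for block graphs that remains usable on all subsets of
  \<open>V\<close>, as the induction requires. The case \<open>U = {z}\<close> is exempt because the
  empty set is never \<open>conn\<close>.\<close>

locale block_relation =
  fixes V :: "'a set" and E :: "('a \<times> 'a) set"
  assumes sym: "sym E" and finite_V: "finite V"
    and clique_if_no_cut:
      "U \<subseteq> V \<Longrightarrow> conn E U \<Longrightarrow> (\<And>z. z \<in> U \<Longrightarrow> U \<noteq> {z} \<Longrightarrow> conn E (U - {z})) \<Longrightarrow> clique E U"
begin

text \<open>
  If \<open>z\<close> is a cut vertex of \<open>T \<union> D\<close>, then one piece left by its removal can be deleted from
  \<open>T\<close> or from \<open>D\<close> without destroying the hypotheses; once there is none, \<open>T \<union> D\<close> is a clique.
\<close>
lemma adj_if_two_attached: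
  assumes "T \<subseteq> V" "D \<subseteq> V" "T \<inter> D = {}" "conn E T" "conn E D"
    and "x \<in> T" "y \<in> T" "x \<noteq> y" "a \<in> D" "b \<in> D" "(x, a) \<in> E" "(y, b) \<in> E"
  shows "(x, y) \<in> E"
  using assms
proof (induction "card (T \<union> D)" arbitrary: T D rule: less_induct)
  case less
  let ?U = "T \<union> D"
  have U: "?U \<subseteq> V" "finite ?U" "conn E ?U"
    using less.prems finite_V conn_Un[OF sym, of T D x a] by (auto intro: finite_subset)
  show ?case
  proof (cases "\<forall>z\<in>?U. ?U \<noteq> {z} \<longrightarrow> conn E (?U - {z})")
    case True
    then have "clique E ?U" using clique_if_no_cut[OF U(1,3)] by blast
    then show ?thesis using less.prems unfolding clique_def by blast
  next
    case False
    then obtain z where z: "z \<in> ?U" "\<not> conn E (?U - {z})" by blast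
    show ?thesis
    proof (cases "z \<in> D")
      case True
      then have "T \<subseteq> ?U - {z}" using less.prems(3) by blast
      then obtain Q where Q: "Q \<subseteq> ?U - {z}" "Q \<noteq> {}" "Q \<inter> T = {}"
        "\<And>p q. p \<in> Q \<Longrightarrow> q \<in> ?U - {z} - Q \<Longrightarrow> (p, q) \<notin> E"
        using not_connE[OF sym z(2) less.prems(4)] by metis
      have "conn E (D - Q)"
        using Q True by (intro conn_Diff[OF sym less.prems(5), of z]) blast+
      \<comment> \<open>The neighbours \<open>x\<close> and \<open>y\<close> of \<open>a\<close> and
        \<open>b\<close> lie in \<open>T\<close>, which avoids \<open>z\<close> and
        \<open>Q\<close>, whereas \<open>Q\<close> sends no edge to the rest of
        \<open>?U - {z}\<close>.\<close>
      moreover have "a \<notin> Q" "b \<notin> Q"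
        using Q(4)[of a x] Q(4)[of b y] Q(3) \<open>T \<subseteq> ?U - {z}\<close> less.prems symD[OF sym] by blast+
      moreover have "card (T \<union> (D - Q)) < card ?U"
        using Q(1-3) U(2) by (intro psubset_card_mono) blast+
      ultimately show ?thesis
        using less.prems by (intro less.hyps[of T "D - Q"]) blast+
    next
      case False
      then have "z \<in> T" "D \<subseteq> ?U - {z}" using z(1) by blast+
      then obtain Q where Q: "Q \<subseteq> ?U - {z}" "Q \<noteq> {}" "Q \<inter> D = {}"
        "\<And>p q. p \<in> Q \<Longrightarrow> q \<in> ?U - {z} - Q \<Longrightarrow> (p, q) \<notin> E"
        using not_connE[OF sym z(2) less.prems(5)] by metis
      have "conn E (T - Q)"
        using Q \<open>z \<in> T\<close> by (intro conn_Diff[OF sym less.prems(4), of z]) blast+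
      moreover have "x \<notin> Q" "y \<notin> Q"
        using Q(4)[of x a] Q(4)[of y b] Q(3) \<open>D \<subseteq> ?U - {z}\<close> less.prems by blast+
      moreover have "card ((T - Q) \<union> D) < card ?U"
        using Q(1-3) U(2) by (intro psubset_card_mono) blast+
      ultimately show ?thesis
        using less.prems by (intro less.hyps[of "T - Q" D]) blast+
    qed
  qed
qed

text \<open>\<open>C\<close> is a component of \<open>W - {v}\<close>, so its edges to
  \<open>W - C\<close> all end in \<open>v\<close>. Two neighbours of \<open>v\<close> in
  \<open>C\<close> are both attached to the connected set \<open>{v}\<close> and hence adjacent,
  which makes \<open>L\<close> a clique.\<close>

lemma clique_cut_vertex:
  assumes W: "W \<subseteq> V" "v \<in> W" and C: "C \<subseteq> W - {v}" "conn E C"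
    and closed: "\<And>p q. p \<in> C \<Longrightarrow> q \<in> W - {v} - C \<Longrightarrow> (p, q) \<notin> E"
  defines "L \<equiv> {p \<in> C. (p, v) \<in> E}"
  shows "clique_cut E C L (W - C) {v}" "gated E C L"
proof -
  have "(p, q) \<in> E" if "p \<in> L" "q \<in> L" "p \<noteq> q" for p q
    using that W C by (intro adj_if_two_attached[of C "{v}" p q v v]) (auto simp: L_def)
  then have "clique E L" unfolding clique_def by blast
  moreover have "(p, q) \<in> E \<longleftrightarrow> p \<in> L \<and> q \<in> {v}" if "p \<in> C" "q \<in> W - C" for p q
    using that closed[of p q] by (cases "q = v") (auto simp: L_def)
  ultimately show "clique_cut E C L (W - C) {v}"
    using W C(1) unfolding clique_cut_def by (auto simp: L_def clique_def)
  show "gated E C L"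
    unfolding gated_def
  proof (intro ballI impI, rule ccontr)
    fix y r s assume y: "y \<in> C - L" and rs: "r \<in> L" "s \<in> L" "(y, r) \<in> E" "(y, s) \<in> E" "r \<noteq> s"
    \<comment> \<open>Both \<open>y\<close> and \<open>v\<close> are adjacent to \<open>s\<close>,
      and \<open>r\<close> connects them inside \<open>{v, y, r}\<close>; this forces
      \<open>y\<close> to be adjacent to \<open>v\<close>.\<close>
    have "conn E {v, y, r}"
      using rs symD[OF sym] conn_insert[OF sym, of "{r}" r y] conn_insert[OF sym, of "{y, r}" r v]
      by (auto simp: L_def)
    moreover have "y \<noteq> s" using y rs by blast
    moreover have "(v, s) \<in> E" using rs symD[OF sym] by (simp add: L_def)
    ultimately have "(y, v) \<in> E"
      using y rs W C by (intro adj_if_two_attached[of "{v, y, r}" "{s}" y v s s]) (auto simp: L_def)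
    then show False using y by (simp add: L_def)
  qed
qed

text \<open>\<open>C\<close> is the branch at \<open>u\<close> after removal of the other root
  vertices. If some \<open>p \<noteq> u\<close> in it were adjacent to
  \<open>q \<in> R - {u}\<close>, then, \<open>u\<close> being adjacent to \<open>q\<close> as well,
  \<open>p\<close> would be adjacent to \<open>u\<close> and have two neighbours in the gated
  \<open>R\<close>.\<close>

lemma clique_cut_clique:
  assumes W: "W \<subseteq> V" and R: "R \<subseteq> W" "clique E R" "gated E W R" "u \<in> R"
    and C: "u \<in> C" "C \<subseteq> W - (R - {u})" "conn E C"
    and closed: "\<And>p q. p \<in> C \<Longrightarrow> q \<in> W - (R - {u}) - C \<Longrightarrow> (p, q) \<notin> E"
  shows "clique_cut E C {u} (W - C) (R - {u})"
proof -
  have uR: "(u, q) \<in> E" if "q \<in> R - {u}" for q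
    using that R(2,4) by (auto simp: clique_def)
  have key: "p = u \<and> q \<in> R - {u}" if "p \<in> C" "q \<in> W - C" "(p, q) \<in> E" for p q
  proof -
    have q: "q \<in> R - {u}" using that closed[of p q] by blast
    have "p = u"
    proof (rule ccontr)
      assume "p \<noteq> u"
      have "(p, u) \<in> E"
        using that q uR[OF q] W C \<open>p \<noteq> u\<close>
        by (intro adj_if_two_attached[of C "{q}" p u q q]) auto
      moreover have "p \<in> W - R" using that(1) C(2) \<open>p \<noteq> u\<close> by blast
      ultimately have "u = q" using R(3,4) q that(3) by (auto simp: gated_def)
      then show False using q by blast
    qed
    with q show ?thesis by blast
  qed
  have "\<forall>p\<in>C. \<forall>q\<in>W - C. (p, q) \<in> E \<longleftrightarrow> p \<in> {u} \<and> q \<in> R - {u}"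
    using key uR by blast
  moreover have "clique E (R - {u})" "clique E {u}" using R(2) by (simp_all add: clique_def)
  moreover have "C \<inter> (W - C) = {}" "{u} \<subseteq> C" "R - {u} \<subseteq> W - C" using R(1) C(1,2) by blast+
  ultimately show ?thesis unfolding clique_cut_def by blast
qed

text \<open>Induction on \<open>card W\<close>. With a one-vertex root, a component of the remaining
  vertices is split off and rooted at its neighbours of the old root. A larger root is split into
  one vertex with its branch and the other root vertices.\<close>

lemma order_sum_avoiding_le:
  assumes "W \<subseteq> V" "conn E W" "R \<subseteq> W" "R \<noteq> {}" "clique E R" "gated E W R"
  shows "order_sum (avoiding E W R) \<le> mean_size (meeting E W R) * card (avoiding E W R)"
  using assms
proof (induction "card W" arbitrary: W R rule: less_induct)
  case less
  have fin: "finite W" using less.prems(1) finite_V finite_subset by blast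
  obtain u where u: "u \<in> R" using less.prems(4) by blast
  then have uW: "u \<in> W" using less.prems(3) by blast
  have W_eq: "C \<union> (W - C) = W" if "C \<subseteq> W" for C using that by blast
  have smaller: "finite C" "finite (W - C)" "card C < card W" "card (W - C) < card W"
    if "C \<subseteq> W" "C \<noteq> {}" "C \<noteq> W" for C
  proof -
    show "finite C" "finite (W - C)" using that fin finite_subset by auto
    show "card C < card W" "card (W - C) < card W"
      using that fin by (auto intro!: psubset_card_mono)
  qed
  \<comment> \<open>\<open>W\<close> itself is a connected set crossing the cut, so its trace
    \<open>W - C\<close> is connected and its trace on \<open>C\<close> meets
    \<open>L\<close>.\<close>
  have rest: "conn E (W - C)" "L \<noteq> {}" if cut: "clique_cut E C L (W - C) L'" and C: "C \<subseteq> W" "C \<noteq> {}" "C \<noteq> W" for C L L'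
  proof -
    have "W \<inter> (W - C) = W - C" "W - C \<noteq> {}" using C by blast+
    then show "conn E (W - C)"
      using conn_Int_clique_cut(1)[OF sym clique_cut_commute[OF sym cut] less.prems(2)] C by auto
    show "L \<noteq> {}"
      using conn_Int_clique_cut(2)[OF sym cut less.prems(2)] C by auto
  qed
  show ?case
  proof (cases "R = {u}")
    case True
    show ?thesis
    proof (cases "W = {u}")
      case True
      then have "avoiding E W R = {}"
        using \<open>R = {u}\<close> conn_nonempty[of E] unfolding avoiding_def by blast
      then show ?thesis by (simp add: order_sum_def)
    next
      case False
      then obtain w where w: "w \<in> W - {u}" using uW by blast
      obtain C where C: "w \<in> C" "C \<subseteq> W - {u}" "conn E C"
        and closed: "\<And>p q. p \<in> C \<Longrightarrow> q \<in> W - {u} - C \<Longrightarrow> (p, q) \<notin> E"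
        using component_exists[OF sym _ w] fin by auto
      define L where "L = {p \<in> C. (p, u) \<in> E}"
      have cut: "clique_cut E C L (W - C) {u}" and gated: "gated E C L"
        unfolding L_def using clique_cut_vertex[OF less.prems(1) uW C(2,3) closed] by blast+
      have CW: "C \<subseteq> W" "C \<noteq> {}" "C \<noteq> W" using C uW by blast+
      note r = rest[OF cut CW] and s = smaller[OF CW]
      have "order_sum (avoiding E C L) \<le> mean_size (meeting E C L) * card (avoiding E C L)"
        using s(3) CW(1) less.prems(1) C(3) r(2) cut gated
        by (intro less.hyps) (auto simp: clique_cut_def)
      moreover have "order_sum (avoiding E (W - C) {u}) \<le> mean_size (meeting E (W - C) {u}) * card (avoiding E (W - C) {u})"
        using s(4) less.prems(1) r(1) cut
        by (intro less.hyps) (auto simp: clique_cut_def gated_def)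
      ultimately have "order_sum (avoiding E (C \<union> (W - C)) {u})
          \<le> mean_size (meeting E (C \<union> (W - C)) {u}) * card (avoiding E (C \<union> (W - C)) {u})"
        by (intro mean_size_one_side[OF sym cut s(1,2) C(3) r(1) r(2)]) auto
      then show ?thesis unfolding W_eq[OF CW(1)] \<open>R = {u}\<close> .
    qed
  next
    case False
    obtain C where C: "u \<in> C" "C \<subseteq> W - (R - {u})" "conn E C"
      and closed: "\<And>p q. p \<in> C \<Longrightarrow> q \<in> W - (R - {u}) - C \<Longrightarrow> (p, q) \<notin> E"
      using component_exists[OF sym, of "W - (R - {u})" u] fin uW by auto
    have cut: "clique_cut E C {u} (W - C) (R - {u})"
      by (rule clique_cut_clique[OF less.prems(1,3,5,6) u C closed])
    have CW: "C \<subseteq> W" "C \<noteq> {}" "C \<noteq> W" using C u False less.prems(3) by blast+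
    note r = rest[OF cut CW] and s = smaller[OF CW]
    have ne: "R - {u} \<noteq> {}" using u False by blast
    have "order_sum (avoiding E C {u}) \<le> mean_size (meeting E C {u}) * card (avoiding E C {u})"
      using s(3) CW(1) less.prems(1) C(1,3)
      by (intro less.hyps) (auto simp: clique_def gated_def)
    \<comment> \<open>A vertex of \<open>W - C\<close> outside \<open>R - {u}\<close> is outside
      \<open>R\<close>, because \<open>u\<close> lies in \<open>C\<close>.\<close>
    moreover have "gated E (W - C) (R - {u})"
      using less.prems(6) C(1) unfolding gated_def by blast
    then have "order_sum (avoiding E (W - C) (R - {u}))
        \<le> mean_size (meeting E (W - C) (R - {u})) * card (avoiding E (W - C) (R - {u}))"
      using s(4) less.prems(1) r(1) cut ne
      by (intro less.hyps) (auto simp: clique_cut_def)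
    ultimately have "order_sum (avoiding E (C \<union> (W - C)) ({u} \<union> (R - {u})))
        \<le> mean_size (meeting E (C \<union> (W - C)) ({u} \<union> (R - {u}))) *
          card (avoiding E (C \<union> (W - C)) ({u} \<union> (R - {u})))"
      using ne by (intro mean_size_both_sides[OF sym cut s(1,2) C(3) r(1)]) auto
    moreover have "{u} \<union> (R - {u}) = R" using u by blast
    ultimately show ?thesis unfolding W_eq[OF CW(1)] by simp
  qed
qed

text \<open>\<open>conn_sets\<close> is the disjoint union of \<open>meeting\<close> and
  \<open>avoiding\<close>, and adjoining sets of no larger mean does not raise a mean.\<close>

lemma mean_size_le_meeting:
  assumes "W \<subseteq> V" "conn E W" "R \<subseteq> W" "R \<noteq> {}" "clique E R" "gated E W R"
  shows "mean_size (conn_sets E W) \<le> mean_size (meeting E W R)"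
proof -
  have fin: "finite W" using assms(1) finite_V finite_subset by blast
  let ?m = "mean_size (meeting E W R)"
  have split: "conn_sets E W = meeting E W R \<union> avoiding E W R" "meeting E W R \<inter> avoiding E W R = {}"
    by (auto simp: conn_sets_def meeting_def avoiding_def)
  have pos: "0 < card (meeting E W R)"
    by (rule order_sum_meeting_bounds(3)[OF sym fin assms(2,3,4)])
  have "order_sum (conn_sets E W) \<le> ?m * card (meeting E W R) + ?m * card (avoiding E W R)"
    using order_sum_avoiding_le[OF assms] pos fin split(2)
    by (simp add: split(1) order_sum_Un mean_size_def card_gt_0_iff)
  also have "\<dots> = ?m * card (conn_sets E W)"
    using fin split(2) by (simp add: split(1) card_Un_disjoint algebra_simps)
  finally have "order_sum (conn_sets E W) \<le> ?m * card (conn_sets E W)" .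
  moreover have "0 < card (conn_sets E W)"
    using pos fin split by (simp add: card_Un_disjoint)
  ultimately show ?thesis by (simp add: mean_size_def[of "conn_sets E W"] divide_le_eq)
qed

end

section \<open>Block graphs\<close>

lemma arcs_ends_induce: "arcs_ends (G \<restriction> U) = arcs_ends G \<inter> U \<times> U"
  by (auto simp: arcs_ends_conv)

lemma conn_arcs_ends_induce: "conn (arcs_ends (G \<restriction> U)) U \<longleftrightarrow> conn (arcs_ends G) U"
  by (rule conn_cong) (simp add: arcs_ends_induce)

lemma (in graph) sym_arcs_ends: "sym (arcs_ends G)"
  using sym_arcs by (simp add: symmetric_def)

lemma (in graph) graph_induce:
  assumes "U \<subseteq> verts G"
  shows "graph (G \<restriction> U)"
proof -
  have ind: "induced_subgraph (G \<restriction> U) G" using assms by (rule induced_induce)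
  show ?thesis
    by (rule digraph.graphI[OF digraphI_induced[OF ind] induced_graph_imp_symmetric[OF sym_arcs ind]])
qed

text \<open>A walk from inside \<open>B\<close> to outside must leave \<open>B\<close> along an arc;
  conversely the set reachable from \<open>u\<close> is closed under arcs, so the cut condition
  makes it everything. The form with reachability serves both connectedness and cut
  vertices.\<close>

lemma (in graph) all_reachable_iff_conn:
  "verts G \<noteq> {} \<and> (\<forall>u\<in>verts G. \<forall>v\<in>verts G. u \<rightarrow>\<^sup>* v) \<longleftrightarrow> conn (arcs_ends G) (verts G)"
proof
  assume reach: "verts G \<noteq> {} \<and> (\<forall>u\<in>verts G. \<forall>v\<in>verts G. u \<rightarrow>\<^sup>* v)"
  show "conn (arcs_ends G) (verts G)"
    unfolding conn_def
  proof (intro conjI allI impI)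
    show "verts G \<noteq> {}" using reach by blast
    fix B assume B: "B \<subseteq> verts G" "B \<noteq> {}" "B \<noteq> verts G"
    then obtain u v where uv: "u \<in> B" "v \<in> verts G" "v \<notin> B" by blast
    show "\<exists>x\<in>B. \<exists>y\<in>verts G - B. x \<rightarrow> y"
    proof (rule ccontr)
      assume closed: "\<not> ?thesis"
      have "u \<rightarrow>\<^sup>* v" using reach uv B(1) by blast
      then have "v \<in> B"
        by (induction rule: reachable_induct) (use uv closed adj_in_verts in blast)+
      then show False using uv by blast
    qed
  qed
next
  assume conn: "conn (arcs_ends G) (verts G)"
  have "u \<rightarrow>\<^sup>* v" if "u \<in> verts G" "v \<in> verts G" for u v
  proof (rule ccontr)
    assume nreach: "\<not> u \<rightarrow>\<^sup>* v"
    let ?B = "{w. u \<rightarrow>\<^sup>* w}"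
    have "?B \<subseteq> verts G" "?B \<noteq> {}" "?B \<noteq> verts G"
      using that nreach reachable_in_verts(2) by auto
    then obtain x y where "x \<in> ?B" "y \<in> verts G" "y \<notin> ?B" "x \<rightarrow> y"
      by (rule connD[OF conn])
    then show False using reachable_adj_trans[of u x y] by simp
  qed
  then show "verts G \<noteq> {} \<and> (\<forall>u\<in>verts G. \<forall>v\<in>verts G. u \<rightarrow>\<^sup>* v)"
    using conn_nonempty[OF conn] by blast
qed

lemma (in graph) connected_iff_conn:
  "Digraph_Component.connected G \<longleftrightarrow> conn (arcs_ends G) (verts G)"
  using all_reachable_iff_conn
  by (simp add: connected_def strongly_connected_def reachable_mk_symmetric_eq[OF sym_arcs])

lemma (in graph) connected_induce_iff_conn:
  "U \<subseteq> verts G \<Longrightarrow> Digraph_Component.connected (G \<restriction> U) \<longleftrightarrow> conn (arcs_ends G) U"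
  using graph.connected_iff_conn[OF graph_induce] by (simp add: conn_arcs_ends_induce)

lemma (in graph) not_cut_vertex:
  assumes "conn (arcs_ends G) (verts G - {v})"
  shows "\<not> cut_vertex G v"
proof -
  let ?H = "G \<restriction> (verts G - {v})"
  have del: "pre_digraph.del_vert G v = ?H"
    using wellformed by (auto simp: del_vert_def induce_subgraph_def)
  interpret H: graph ?H by (rule graph_induce) blast
  have "\<forall>x\<in>verts G - {v}. \<forall>y\<in>verts G - {v}. x \<rightarrow>\<^sup>*\<^bsub>?H\<^esub> y"
    using H.all_reachable_iff_conn assms by (simp add: conn_arcs_ends_induce)
  then show ?thesis unfolding cut_vertex_def del by blast
qed

lemma (in graph) not_cut_vertex_trivial: "verts G \<subseteq> {v} \<Longrightarrow> \<not> cut_vertex G v"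
  unfolding cut_vertex_def by blast

text \<open>Among the subgraphs above \<open>H\<close> satisfying \<open>P\<close>, one with the
  most vertices and arcs together is maximal: an extension no larger than it has the same vertices
  and arcs.\<close>

lemma (in graph) exists_max_subgraph:
  assumes "subgraph H G" "P H"
  obtains B where "max_subgraph P B" "subgraph H B"
proof -
  let ?Q = "\<lambda>B. subgraph H B \<and> subgraph B G \<and> P B"
  let ?size = "\<lambda>B. card (verts B) + card (arcs B)"
  have "?Q H" using assms by (auto simp: subgraph_def compatible_def)
  moreover have "?size B < Suc (?size G)" if "?Q B" for B
    using that by (simp add: subgraph_def card_mono add_mono less_Suc_eq_le)
  ultimately have "\<exists>B. ?Q B \<and> (\<forall>B'. ?Q B' \<longrightarrow> ?size B' \<le> ?size B)"
    by (intro ex_has_greatest_nat[of ?Q H ?size "Suc (?size G)"]) auto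
  then obtain B where B: "subgraph H B" "subgraph B G" "P B"
    and max: "\<And>B'. subgraph H B' \<Longrightarrow> subgraph B' G \<Longrightarrow> P B' \<Longrightarrow> ?size B' \<le> ?size B" by auto
  have "B' = B" if B': "subgraph B B'" "subgraph B' G" "P B'" for B'
  proof -
    have fin: "finite (verts B')" "finite (arcs B')"
      using B'(2) by (auto simp: subgraph_def intro: finite_subset)
    have sub: "verts B \<subseteq> verts B'" "arcs B \<subseteq> arcs B'" using B'(1) by auto
    have "?size B' \<le> ?size B" by (rule max[OF subgraph_trans[OF B(1) B'(1)] B'(2,3)])
    moreover have "card (verts B) \<le> card (verts B')" "card (arcs B) \<le> card (arcs B')"
      using fin sub by (simp_all add: card_mono)
    ultimately have "card (verts B') \<le> card (verts B)" "card (arcs B') \<le> card (arcs B)" by linarith+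
    then have "verts B = verts B'" "arcs B = arcs B'"
      using fin sub by (simp_all add: card_seteq)
    then show "B' = B" using B'(1) by (auto simp: subgraph_def compatible_def)
  qed
  then have "max_subgraph P B" using B(2,3) unfolding max_subgraph_def by blast
  then show thesis using B(1) by (rule that)
qed

text \<open>A connected \<open>U\<close> without cut vertices induces a subgraph that extends to a
  block. That block is complete, so the vertices of \<open>U\<close> are pairwise adjacent.\<close>

lemma block_relation_arcs_ends:
  assumes "block_graph G"
  shows "block_relation (verts G) (arcs_ends G)"
proof -
  interpret graph G using assms by (simp add: block_graph_def)
  show ?thesis
  proof
    show "sym (arcs_ends G)" by (rule sym_arcs_ends)
    show "finite (verts G)" by simp
    fix U assume U: "U \<subseteq> verts G" "conn (arcs_ends G) U"
      and no_cut: "\<And>z. z \<in> U \<Longrightarrow> U \<noteq> {z} \<Longrightarrow> conn (arcs_ends G) (U - {z})"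
    let ?H = "G \<restriction> U"
    interpret H: graph ?H by (rule graph_induce[OF U(1)])
    have "\<not> cut_vertex ?H v" for v
    proof (cases "v \<in> U \<and> U \<noteq> {v}")
      case True
      then have "conn (arcs_ends ?H) (verts ?H - {v})"
        using no_cut[of v] conn_cong[of "U - {v}" "arcs_ends ?H" "arcs_ends G"]
        by (simp add: arcs_ends_induce)
      then show ?thesis by (rule H.not_cut_vertex)
    next
      case False
      then show ?thesis using H.not_cut_vertex_trivial[of v] by (auto simp: cut_vertex_def)
    qed
    then have "graph ?H \<and> Digraph_Component.connected ?H \<and> (\<nexists>v. cut_vertex ?H v)"
      using connected_induce_iff_conn[OF U(1)] U(2) H.graph_axioms by simp
    then obtain B where "max_subgraph (\<lambda>H. graph H \<and> Digraph_Component.connected H \<and> (\<nexists>v. cut_vertex H v)) B"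
      and sub: "subgraph ?H B"
      by (rule exists_max_subgraph[OF subgraph_induce_subgraphI[OF U(1)]])
    then have B: "block G B" by (simp add: block_def)
    have UB: "U \<subseteq> verts B" using subgraph_imp_subverts[OF sub] by simp
    have ends: "arcs_ends B = {(u, v). (u, v) \<in> verts B \<times> verts B \<and> u \<noteq> v}"
      using B assms by (simp add: block_graph_def complete_digraph_def)
    have BG: "arcs_ends B \<subseteq> arcs_ends G"
      using B by (intro arcs_ends_mono) (simp add: block_def max_subgraph_def)
    show "clique (arcs_ends G) U"
      unfolding clique_def
    proof (intro ballI impI)
      fix x y assume "x \<in> U" "y \<in> U" "x \<noteq> y"
      then have "(x, y) \<in> arcs_ends B" using UB by (auto simp: ends)
      then show "(x, y) \<in> arcs_ends G" using BG by blast
    qed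
  qed
qed

section \<open>Blocks as gated cliques\<close>

lemma conn_if_clique:
  assumes "A \<noteq> {}" "clique E A"
  shows "conn E A"
  unfolding conn_def
proof (intro conjI allI impI)
  show "A \<noteq> {}" by fact
  fix B assume "B \<subseteq> A" "B \<noteq> {}" "B \<noteq> A"
  then obtain x y where xy: "x \<in> B" "y \<in> A - B" by blast
  then have "(x, y) \<in> E" using assms(2) \<open>B \<subseteq> A\<close> by (auto simp: clique_def)
  then show "\<exists>x\<in>B. \<exists>y\<in>A - B. (x, y) \<in> E" using xy by blast
qed

text \<open>For gatedness: a vertex \<open>y\<close> outside the block with two neighbours in it is
  adjacent to all of it. Adding \<open>y\<close> then gives a larger clique, whose induced subgraph
  is connected without cut vertices, against maximality.\<close>

lemma
  assumes G: "block_graph G" and B: "block G B"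
  shows clique_block: "clique (arcs_ends G) (verts B)"
    and block_subset: "verts B \<subseteq> verts G"
    and block_nonempty: "verts B \<noteq> {}"
    and gated_block: "gated (arcs_ends G) (verts G) (verts B)"
proof -
  interpret graph G using G by (simp add: block_graph_def)
  interpret block_relation "verts G" "arcs_ends G" by (rule block_relation_arcs_ends[OF G])
  let ?E = "arcs_ends G" and ?P = "\<lambda>H. graph H \<and> Digraph_Component.connected H \<and> (\<nexists>v. cut_vertex H v)"
  have max: "max_subgraph ?P B" using B by (simp add: block_def)
  have sub: "subgraph B G" using max by (rule subgraphI_max_subgraph)
  then show subset: "verts B \<subseteq> verts G" by auto
  have ends: "arcs_ends B = {(u, v). (u, v) \<in> verts B \<times> verts B \<and> u \<noteq> v}"
    using B G by (simp add: block_graph_def complete_digraph_def)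
  then show clique: "clique ?E (verts B)"
    using arcs_ends_mono[OF sub] unfolding clique_def by blast
  show "verts B \<noteq> {}"
    using max by (auto simp: max_subgraph_def connected_def strongly_connected_def)
  show "gated ?E (verts G) (verts B)"
    unfolding gated_def
  proof (intro ballI impI, rule ccontr)
    fix y r s assume y: "y \<in> verts G - verts B" and rs: "r \<in> verts B" "s \<in> verts B"
      "(y, r) \<in> ?E" "(y, s) \<in> ?E" "r \<noteq> s"
    \<comment> \<open>Both \<open>y\<close> and \<open>b\<close> are adjacent to \<open>s\<close>,
      and \<open>r\<close> links them inside \<open>{y, r, b}\<close>, so being attached twice to
      \<open>{s}\<close> makes them adjacent.\<close>
    have adj: "(y, b) \<in> ?E" if b: "b \<in> verts B" for b
    proof (cases "b = s")
      case False
      have bs: "(b, s) \<in> ?E" using clique b rs(2) False by (simp add: clique_def)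
      have "conn ?E {y, r, b}"
      proof (cases "b = r")
        case True
        then show ?thesis using conn_insert[OF sym, of "{r}" r y] symD[OF sym rs(3)] by auto
      next
        case False
        then have "(r, b) \<in> ?E" using clique b rs(1) by (simp add: clique_def)
        then show ?thesis
          using conn_insert[OF sym, of "{r}" r b] conn_insert[OF sym, of "{b, r}" r y] symD[OF sym rs(3)]
          by (auto simp: insert_commute)
      qed
      then show ?thesis
        using y rs b False bs subset
        by (intro adj_if_two_attached[of "{y, r, b}" "{s}" y b s s]) auto
    qed (use rs in simp)
    define U where "U = insert y (verts B)"
    have U: "U \<subseteq> verts G" using y subset by (auto simp: U_def)
    have clU: "clique ?E U"
      using clique adj symD[OF sym] by (auto simp: U_def clique_def)
    let ?H = "G \<restriction> U"
    interpret H: graph ?H by (rule graph_induce[OF U])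
    have "\<not> cut_vertex ?H v" for v
    proof (cases "U \<subseteq> {v}")
      case False
      have "clique (arcs_ends ?H) (U - {v})"
        using clU by (auto simp: arcs_ends_induce clique_def)
      moreover have "U - {v} \<noteq> {}" using False by blast
      ultimately have "conn (arcs_ends ?H) (verts ?H - {v})" by (simp add: conn_if_clique)
      then show ?thesis by (rule H.not_cut_vertex)
    qed (use H.not_cut_vertex_trivial in simp)
    moreover have "Digraph_Component.connected ?H"
      using connected_induce_iff_conn[OF U] conn_if_clique[OF _ clU] by (auto simp: U_def)
    ultimately have "?P ?H" using H.graph_axioms by simp
    moreover have "subgraph ?H G" by (rule subgraph_induce_subgraphI[OF U])
    moreover have "subgraph B ?H"
      using sub wf_digraph.wellformed[of B]
      by (auto simp: subgraph_def compatible_def U_def H.wf_digraph)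
    moreover have "?H \<noteq> B" using y by (metis DiffD2 U_def induce_subgraph_verts insertI1)
    ultimately show False using max unfolding max_subgraph_def by blast
  qed
qed

text \<open>Induced subgraphs correspond one to one to their vertex sets. The predicate
  \<open>P\<close> lets one statement serve all three means.\<close>

lemma (in graph) mean_order_conn_induced_subgraphs:
  "mean_order {H \<in> conn_induced_subgraphs G. P (verts H)} =
    mean_size {A. A \<subseteq> verts G \<and> conn (arcs_ends G) A \<and> P A}"
proof -
  let ?S = "{A. A \<subseteq> verts G \<and> conn (arcs_ends G) A \<and> P A}"
  have eq: "{H \<in> conn_induced_subgraphs G. P (verts H)} = (\<lambda>A. G \<restriction> A) ` ?S"
  proof (intro equalityI subsetI)
    fix H assume "H \<in> {H \<in> conn_induced_subgraphs G. P (verts H)}"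
    then have H: "induced_subgraph H G" "Digraph_Component.connected H" "P (verts H)"
      by (auto simp: conn_induced_subgraphs_def)
    then have "H = G \<restriction> verts H" "verts H \<subseteq> verts G"
      by (auto simp: induced_subgraph_def subgraph_def compatible_def induce_subgraph_def)
    then show "H \<in> (\<lambda>A. G \<restriction> A) ` ?S"
      using H connected_induce_iff_conn[of "verts H"] by (intro image_eqI[of _ _ "verts H"]) auto
  next
    fix H assume "H \<in> (\<lambda>A. G \<restriction> A) ` ?S"
    then show "H \<in> {H \<in> conn_induced_subgraphs G. P (verts H)}"
      using connected_induce_iff_conn induced_induce by (auto simp: conn_induced_subgraphs_def)
  qed
  have "inj_on (\<lambda>A. G \<restriction> A) ?S" by (rule inj_onI) (metis induce_subgraph_verts)
  then show ?thesis
    by (simp add: eq mean_order_def mean_size_def order_sum_def card_image sum.reindex)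
qed

theorem theorem4p7:
  fixes G :: "('a, 'b) pre_digraph"
  assumes "block_graph G" and "Digraph_Component.connected G"
  shows "(\<forall>v \<in> verts G. M_all G \<le> M_vertex G v) \<and>
         (\<forall>B. block G B \<longrightarrow> M_all G \<le> M_block G B)"
proof -
  interpret graph G using assms by (simp add: block_graph_def)
  interpret block_relation "verts G" "arcs_ends G" by (rule block_relation_arcs_ends[OF assms(1)])
  let ?E = "arcs_ends G" and ?V = "verts G"
  have all: "M_all G = mean_size (conn_sets ?E ?V)"
    using mean_order_conn_induced_subgraphs[of "\<lambda>_. True"] by (simp add: M_all_def conn_sets_def)
  have vertex: "M_vertex G v = mean_size (meeting ?E ?V {v})" for v
    using mean_order_conn_induced_subgraphs[of "\<lambda>A. v \<in> A"] by (simp add: M_vertex_def meeting_def)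
  have block: "M_block G B = mean_size (meeting ?E ?V (verts B))" for B
    using mean_order_conn_induced_subgraphs[of "\<lambda>A. A \<inter> verts B \<noteq> {}"]
    by (simp add: M_block_def meeting_def)
  have conn: "conn ?E ?V" using assms(2) by (simp add: connected_iff_conn)
  \<comment> \<open>A single vertex is a clique and gated for trivial reasons, so it is an
    admissible root.\<close>
  have "M_all G \<le> M_vertex G v" if "v \<in> ?V" for v
    unfolding all vertex using that conn
    by (intro mean_size_le_meeting) (auto simp: clique_def gated_def)
  moreover have "M_all G \<le> M_block G B" if "block G B" for B
    unfolding all block using conn clique_block[OF assms(1) that] block_subset[OF assms(1) that]
      block_nonempty[OF assms(1) that] gated_block[OF assms(1) that]
    by (intro mean_size_le_meeting) auto
  ultimately show ?thesis by blast
qed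

end
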